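(* Let $\tau\in\{*,\dagger\}$ (with $n$ even if $\tau=\dagger$), let $\iota=\iota_0+1/2$ with $\iota_0\in\mathbb Z$, and let $\mathcal M$ be a weighted $\mathcal L^{\tau,\vec m}_{\iota_0,\epsilon}$-module generated by a subspace $\mathcal M_0$ such that $\mathcal L^{\tau,\vec m,s}_{\iota_0,\epsilon}(\mathcal M_0)=\{0\}$ for some $s\in\mathbb N$ with $s>\hat\ell$. Then the representation $\sigma_\tau$ on $\mathcal M$ (of $\hat o(\vec\ell,\mathbb A)$ if $\tau=*$, of $\widehat{sp}(\vec\ell,\mathbb A)$ if $\tau=\dagger$) is irreducible if and only if $\mathcal M$ is irreducible as an $\mathcal L^{\tau,\vec m}_{\iota_0,\epsilon}$-module.
   Context: All spaces are over $\mathbb C$; $\mathbb N$ = nonnegative integers; $\overline{1,n}=\{1,\dots,n\}$; $\mathcal Z=\mathbb Z+1/2$; $\langle\mu\rangle_0=1$, $\langle\mu\rangle_m=\mu(\mu-1)\cdots(\mu-m+1)$. For $l\in\mathbb Z$ let $l_R\in\overline{1,n}$ be its residue modulo $n$, i.e. $l=l_Qn+l_R$. $\partial_t=d/dt$, $\mathbb A=\sum_{i\ge0}\mathbb C[t,t^{-1}]\partial_t^i$, $E_{i,j}$ the $n\times n$ matrix units. Put $i^*=n+1-i$; fix $\epsilon\in\{0,1\}$ and $\vec\ell\in\mathbb N^n$ with $\ell_i=\ell_{i^*}=2m_i+\epsilon$, $m_i\in\mathbb N$; $\vec m=(m_1,\dots,m_n)$. If $n=2n_0$, $p(i)=0$ and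 $p(n_0+i)=1$ for $i\in\overline{1,n_0}$. Put $s^*_{i,j}=1$ and $s^\dagger_{i,j}=(-1)^{p(i)+p(j)}$. $\widehat{gl}(n,\mathbb A)=M_{n\times n}(\mathbb A)\oplus\mathbb C\kappa$ has $\kappa$ central and $$[t^{m_1}\partial_t^{r_1}E_{i_1,j_1},t^{m_2}\partial_t^{r_2}E_{i_2,j_2}]=\delta_{j_1,i_2}t^{m_1}\partial_t^{r_1}\cdot t^{m_2}\partial_t^{r_2}E_{i_1,j_2}-\delta_{i_1,j_2}t^{m_2}\partial_t^{r_2}\cdot t^{m_1}\partial_t^{r_1}E_{i_2,j_1}+(-1)^{r_1}\delta_{i_1,j_2}\delta_{j_1,i_2}\delta_{r_1+r_2,m_1+m_2}r_1!r_2!\binom{m_1}{r_1+r_2+1}\kappa$$ (here $m_1,m_2\in\mathbb Z$ are arbitrary exponents). $\hat o(\vec\ell,\mathbb A)$ (for $\tau=*$) and $\widehat{sp}(\vec\ell,\mathbb A)$ (for $\tau=\dagger$, $n$ even) are the Lie subalgebras spanned by $\kappa$ and all $t^m\partial_t^{r+\ell_j}E_{i,j}-(-1)^\epsilon s^\tau_{i,j}(-\partial_t)^rt^m\partial_t^{\ell_i}E_{j^*,i^*}$ ($i,j\in\overline{1,n}$, $r\in\mathbb N$, $m\in\mathbb Z$). $\overline{gl}(\infty)$ has basis $\{\mathcal E_{l,k}\mid l,k\in\mathcal Z\}$ with $\mathcal E_{l_1,l_2}\mathcal E_{k_1,k_2}=\delta_{l_2+k_1,0}\mathcal E_{l_1,k_2}$.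 $H(l)=1$ for $l>0$ and $0$ for $l<0$. Define $$\alpha(l_1,l_2;k_1,k_2)=\delta_{l_1+k_2,0}\delta_{l_2+k_1,0}\bigl[H(l_1+(m_{(l_1+1/2)_R}-\iota_0)n)H(l_2+(\iota_0-m_{(-l_2+1/2)_R})n)-H(k_1+(m_{(k_1+1/2)_R}-\iota_0)n)H(k_2+(\iota_0-m_{(-k_2+1/2)_R})n)\bigr].$$ $\widetilde{gl}^{\iota_0}_{\vec m}(\infty)=\overline{gl}(\infty)\oplus\mathbb C\kappa_0$ is the Lie algebra with $\kappa_0$ central and $[\mathcal E_{l_1,l_2},\mathcal E_{k_1,k_2}]=\mathcal E_{l_1,l_2}\mathcal E_{k_1,k_2}-\mathcal E_{k_1,k_2}\mathcal E_{l_1,l_2}+\alpha(l_1,l_2;k_1,k_2)\kappa_0$. For $i,j\in\overline{1,n}$, $l,k\in\mathbb Z$ put $$X^\tau_{i,j}(l,k)=(-1)^\epsilon\langle k+m_j+\epsilon-3/2\rangle_{\ell_j}\mathcal E_{ln+i-1/2,\,kn-j+1/2}-s^\tau_{i,j}\langle l+m_i+1/2\rangle_{\ell_i}\mathcal E_{(k+\epsilon-1)n-j+1/2,\,(l+1-\epsilon)n+i-1/2}.$$ $\mathcal L^{\tau,\vec m}_{\iota_0,\epsilon}$ is the Lie subalgebra of $\widetilde{gl}^{\iota_0}_{\vec m}(\infty)$ spanned by $\kappa_0$ and all $X^\tau_{i,j}(l,k)$. Its toral Cartan subalgebra is $\mathcal T^\epsilon=\sum_l\mathbb C\vartheta^\epsilon_l+\mathbb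 C\kappa_0$, where $\vartheta^\epsilon_l=\mathcal E_{l-1/2,-l+1/2}-\mathcal E_{-l+(\epsilon-1)n+1/2,\,l+(1-\epsilon)n-1/2}$ and $l$ runs over integers with $l\ge-\lfloor n/2\rfloor$ if $\epsilon=0$ and $l\ge0$ if $\epsilon=1$; a module is weighted if it is the direct sum of its $\mathcal T^\epsilon$-weight spaces. $\hat\ell=|\iota_0|+1+\max\{m_1,\dots,m_n\}$. For $s>\hat\ell$, $\mathcal L^{\tau,\vec m,s}_{\iota_0,\epsilon}$ is the span of all $X^\tau_{i,j}(l,k)$ with either $l\ge s$ and $k\le-s$, or $l\le-s$ and $k\ge s$. The representation $\sigma_\tau$ on $\mathcal M$ is given by $\sigma_\tau(\kappa)=\kappa_0$ and, for $i,j\in\overline{1,n}$, $k\in\mathbb Z$, $r\in\mathbb N$, with $N=k+m_i+m_j+r+\epsilon$, $$\sigma_\tau\bigl(t^N\partial_t^{r+\ell_j}E_{i,j}-(-1)^\epsilon s^\tau_{i,j}(-\partial_t)^rt^N\partial_t^{\ell_i}E_{j^*,i^*}\bigr)=\sum_{l\in\mathbb Z}\langle l-m_j-\epsilon+1/2\rangle_rX^\tau_{i,j}(k+l,-l)+\bigl((r+\ell_i)!\,\Im_{0,r+\ell_i}-(-1)^\epsilon r!\,\ell_i!\,\Im_{r,\ell_i}\bigr)\delta_{k,0}\delta_{i,j}\kappa_0,$$ where $\sum_{r_1,r_2\ge0}\Im_{r_1,r_2}x^{r_1}y^{r_2}z^{-r_1-r_2-1}=\frac1{x-y}\bigl((\frac{z+y}{z+x})^\iota-1\bigr)$,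 expanded in nonnegative powers of $x,y$. *)

theory Defs
  imports
    "HOL-Library.Poly_Mapping"
    "HOL-Library.FuncSet"
    "HOL-Computational_Algebra.Formal_Power_Series"
begin

text \<open>
  A complex vector space with a given basis \<open>'b\<close> is the type \<open>'b \<Rightarrow>\<^sub>0 complex\<close> of finitely
  supported functions. Its scalar multiplication is not provided by the library.
\<close>

definition pm_scale :: "complex \<Rightarrow> ('b \<Rightarrow>\<^sub>0 complex) \<Rightarrow> ('b \<Rightarrow>\<^sub>0 complex)" where
  "pm_scale c x = Poly_Mapping.map (\<lambda>a. c * a) x"

lemma lookup_pm_scale [simp]:
  "Poly_Mapping.lookup (pm_scale c x) b = c * Poly_Mapping.lookup x b"
  by (simp add: pm_scale_def Poly_Mapping.map.rep_eq when_def)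

lemma vector_space_pm_scale: "vector_space pm_scale"
  by unfold_locales (auto intro!: poly_mapping_eqI simp: lookup_add algebra_simps)

abbreviation pm_span :: "('b \<Rightarrow>\<^sub>0 complex) set \<Rightarrow> ('b \<Rightarrow>\<^sub>0 complex) set" where
  "pm_span \<equiv> module.span pm_scale"

definition bilinear_ext ::
  "('b \<Rightarrow> 'b \<Rightarrow> ('b \<Rightarrow>\<^sub>0 complex)) \<Rightarrow> ('b \<Rightarrow>\<^sub>0 complex) \<Rightarrow> ('b \<Rightarrow>\<^sub>0 complex) \<Rightarrow> ('b \<Rightarrow>\<^sub>0 complex)" where
  "bilinear_ext c x y =
     (\<Sum>a\<in>Poly_Mapping.keys x. \<Sum>b\<in>Poly_Mapping.keys y.
        pm_scale (Poly_Mapping.lookup x a * Poly_Mapping.lookup y b) (c a b))"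


section \<open>Representations\<close>

text \<open>
  The representation space is the whole type \<open>'m\<close> with scalar multiplication \<open>scale\<close>;
  the Lie algebra is a subspace \<open>L\<close> of \<open>'b \<Rightarrow>\<^sub>0 complex\<close> with bracket \<open>br\<close>, and the
  values of \<open>\<rho>\<close> outside \<open>L\<close> are irrelevant.
\<close>

definition lie_rep ::
  "(complex \<Rightarrow> 'm::ab_group_add \<Rightarrow> 'm) \<Rightarrow> ('b \<Rightarrow>\<^sub>0 complex) set
    \<Rightarrow> (('b \<Rightarrow>\<^sub>0 complex) \<Rightarrow> ('b \<Rightarrow>\<^sub>0 complex) \<Rightarrow> ('b \<Rightarrow>\<^sub>0 complex))
    \<Rightarrow> (('b \<Rightarrow>\<^sub>0 complex) \<Rightarrow> 'm \<Rightarrow> 'm) \<Rightarrow> bool" where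
  "lie_rep scale L br \<rho> \<longleftrightarrow>
     (\<forall>x\<in>L. Vector_Spaces.linear scale scale (\<rho> x)) \<and>
     (\<forall>x\<in>L. \<forall>y\<in>L. \<forall>v. \<rho> (x + y) v = \<rho> x v + \<rho> y v) \<and>
     (\<forall>c. \<forall>x\<in>L. \<forall>v. \<rho> (pm_scale c x) v = scale c (\<rho> x v)) \<and>
     (\<forall>x\<in>L. \<forall>y\<in>L. \<forall>v. \<rho> (br x y) v = \<rho> x (\<rho> y v) - \<rho> y (\<rho> x v))"

definition submodule ::
  "(complex \<Rightarrow> 'm::ab_group_add \<Rightarrow> 'm) \<Rightarrow> ('b \<Rightarrow>\<^sub>0 complex) set
    \<Rightarrow> (('b \<Rightarrow>\<^sub>0 complex) \<Rightarrow> 'm \<Rightarrow> 'm) \<Rightarrow> 'm set \<Rightarrow> bool" where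
  "submodule scale L \<rho> U \<longleftrightarrow> module.subspace scale U \<and> (\<forall>x\<in>L. \<forall>u\<in>U. \<rho> x u \<in> U)"

definition irreducible_rep ::
  "(complex \<Rightarrow> 'm::ab_group_add \<Rightarrow> 'm) \<Rightarrow> ('b \<Rightarrow>\<^sub>0 complex) set
    \<Rightarrow> (('b \<Rightarrow>\<^sub>0 complex) \<Rightarrow> 'm \<Rightarrow> 'm) \<Rightarrow> bool" where
  "irreducible_rep scale L \<rho> \<longleftrightarrow>
     (UNIV :: 'm set) \<noteq> {0} \<and> (\<forall>U. submodule scale L \<rho> U \<longrightarrow> U = {0} \<or> U = UNIV)"

definition generated_submodule ::
  "(complex \<Rightarrow> 'm::ab_group_add \<Rightarrow> 'm) \<Rightarrow> ('b \<Rightarrow>\<^sub>0 complex) set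
    \<Rightarrow> (('b \<Rightarrow>\<^sub>0 complex) \<Rightarrow> 'm \<Rightarrow> 'm) \<Rightarrow> 'm set \<Rightarrow> 'm set" where
  "generated_submodule scale L \<rho> S = \<Inter>{U. submodule scale L \<rho> U \<and> S \<subseteq> U}"

text \<open>Linear functionals on a subspace \<open>T\<close>; extensionality makes them determined by their
  restriction to \<open>T\<close>.\<close>

definition linear_functionals :: "('b \<Rightarrow>\<^sub>0 complex) set \<Rightarrow> (('b \<Rightarrow>\<^sub>0 complex) \<Rightarrow> complex) set" where
  "linear_functionals T =
     {w \<in> extensional T. (\<forall>x\<in>T. \<forall>y\<in>T. w (x + y) = w x + w y) \<and>
                         (\<forall>c. \<forall>x\<in>T. w (pm_scale c x) = c * w x)}"

definition weight_space ::
  "(complex \<Rightarrow> 'm::ab_group_add \<Rightarrow> 'm) \<Rightarrow> ('b \<Rightarrow>\<^sub>0 complex) set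
    \<Rightarrow> (('b \<Rightarrow>\<^sub>0 complex) \<Rightarrow> 'm \<Rightarrow> 'm) \<Rightarrow> (('b \<Rightarrow>\<^sub>0 complex) \<Rightarrow> complex) \<Rightarrow> 'm set" where
  "weight_space scale T \<rho> w = {v. \<forall>h\<in>T. \<rho> h v = scale (w h) v}"

definition weighted ::
  "(complex \<Rightarrow> 'm::ab_group_add \<Rightarrow> 'm) \<Rightarrow> ('b \<Rightarrow>\<^sub>0 complex) set
    \<Rightarrow> (('b \<Rightarrow>\<^sub>0 complex) \<Rightarrow> 'm \<Rightarrow> 'm) \<Rightarrow> bool" where
  "weighted scale T \<rho> \<longleftrightarrow>
     (\<forall>v. \<exists>!f :: (('b \<Rightarrow>\<^sub>0 complex) \<Rightarrow> complex) \<Rightarrow>\<^sub>0 'm.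
        Poly_Mapping.keys f \<subseteq> linear_functionals T \<and>
        (\<forall>w\<in>Poly_Mapping.keys f. Poly_Mapping.lookup f w \<in> weight_space scale T \<rho> w) \<and>
        v = (\<Sum>w\<in>Poly_Mapping.keys f. Poly_Mapping.lookup f w))"


section \<open>Conventions\<close>

definition ffact :: "nat \<Rightarrow> complex \<Rightarrow> complex" where
  "ffact r \<mu> = (\<Prod>i<r. \<mu> - of_nat i)"

text \<open>The residue \<open>l\<^sub>R\<close> lies in \<open>{1..n}\<close>, not in \<open>{0..<n}\<close>.\<close>

definition res :: "nat \<Rightarrow> int \<Rightarrow> nat" where
  "res n l = nat ((l - 1) mod int n) + 1"

definition star :: "nat \<Rightarrow> nat \<Rightarrow> nat" where
  "star n i = n + 1 - i"

definition ell :: "nat \<Rightarrow> (nat \<Rightarrow> nat) \<Rightarrow> nat \<Rightarrow> nat" where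
  "ell \<epsilon> m i = 2 * m i + \<epsilon>"

definition par :: "nat \<Rightarrow> nat \<Rightarrow> nat" where
  "par n i = (if i \<le> n div 2 then 0 else 1)"

datatype inv_kind = Star | Dagger

definition sgn_kind :: "inv_kind \<Rightarrow> nat \<Rightarrow> nat \<Rightarrow> nat \<Rightarrow> complex" where
  "sgn_kind \<tau> n i j = (case \<tau> of Star \<Rightarrow> 1 | Dagger \<Rightarrow> (-1) ^ (par n i + par n j))"


section \<open>Matrix differential operators\<close>

text \<open>\<open>TDE N r i j\<close> stands for \<open>t\<^sup>N \<partial>\<^sub>t\<^sup>r E\<^bsub>i,j\<^esub>\<close>, and \<open>Kappa\<close> for \<open>\<kappa>\<close>. The algebra
  \<open>gl(n,A)^\<close> is the span of \<open>Kappa\<close> and the \<open>TDE N r i j\<close> with \<open>i, j \<in> {1..n}\<close>; the bracket does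
  not depend on \<open>n\<close>.\<close>

datatype glA_basis = TDE int nat nat nat | Kappa

type_synonym glA = "glA_basis \<Rightarrow>\<^sub>0 complex"

text \<open>\<open>(t\<^bsup>N1\<^esup> \<partial>\<^bsup>r1\<^esup> \<cdot> t\<^bsup>N2\<^esup> \<partial>\<^bsup>r2\<^esup>) E\<^bsub>i,j\<^esub>\<close>, brought into normal order by the Leibniz rule
  \<open>\<partial>\<^bsup>r\<^esup> \<cdot> t\<^bsup>N\<^esup> = (\<Sum>q\<le>r. (r choose q) \<langle>N\<rangle>\<^bsub>q\<^esub> t\<^bsup>N-q\<^esup> \<partial>\<^bsup>r-q\<^esup>)\<close>.\<close>

definition dop_prod :: "int \<Rightarrow> nat \<Rightarrow> int \<Rightarrow> nat \<Rightarrow> nat \<Rightarrow> nat \<Rightarrow> glA" where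
  "dop_prod N1 r1 N2 r2 i j =
     (\<Sum>q\<le>r1. Poly_Mapping.single (TDE (N1 + N2 - int q) (r1 + r2 - q) i j)
               (of_nat (r1 choose q) * ffact q (of_int N2)))"

fun glA_basis_bracket :: "glA_basis \<Rightarrow> glA_basis \<Rightarrow> glA" where
  "glA_basis_bracket (TDE N1 r1 i1 j1) (TDE N2 r2 i2 j2) =
     (if j1 = i2 then dop_prod N1 r1 N2 r2 i1 j2 else 0)
   - (if i1 = j2 then dop_prod N2 r2 N1 r1 i2 j1 else 0)
   + Poly_Mapping.single Kappa
       (if i1 = j2 \<and> j1 = i2 \<and> int (r1 + r2) = N1 + N2
        then (-1) ^ r1 * fact r1 * fact r2 * (of_int N1 gchoose (r1 + r2 + 1)) else 0)"
| "glA_basis_bracket _ _ = 0"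

definition glA_bracket :: "glA \<Rightarrow> glA \<Rightarrow> glA" where
  "glA_bracket = bilinear_ext glA_basis_bracket"

text \<open>\<open>t\<^sup>N \<partial>\<^bsup>r+\<ell>\<^sub>j\<^esup> E\<^bsub>i,j\<^esub> - (-1)\<^sup>\<epsilon> s\<^bsub>i,j\<^esub> (-\<partial>)\<^sup>r t\<^sup>N \<partial>\<^bsup>\<ell>\<^sub>i\<^esup> E\<^bsub>j*,i*\<^esub>\<close>\<close>

definition dop_gen ::
  "inv_kind \<Rightarrow> nat \<Rightarrow> nat \<Rightarrow> (nat \<Rightarrow> nat) \<Rightarrow> nat \<Rightarrow> nat \<Rightarrow> nat \<Rightarrow> int \<Rightarrow> glA" where
  "dop_gen \<tau> n \<epsilon> m i j r N =
     Poly_Mapping.single (TDE N (r + ell \<epsilon> m j) i j) 1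
   - pm_scale ((-1) ^ \<epsilon> * sgn_kind \<tau> n i j * (-1) ^ r)
       (dop_prod 0 r N (ell \<epsilon> m i) (star n j) (star n i))"

text \<open>The orthogonal algebra for \<open>\<tau> = Star\<close>, the symplectic one for \<open>\<tau> = Dagger\<close>.\<close>

definition dop_algebra :: "inv_kind \<Rightarrow> nat \<Rightarrow> nat \<Rightarrow> (nat \<Rightarrow> nat) \<Rightarrow> glA set" where
  "dop_algebra \<tau> n \<epsilon> m =
     pm_span (insert (Poly_Mapping.single Kappa 1)
       {dop_gen \<tau> n \<epsilon> m i j r N | i j r N. i \<in> {1..n} \<and> j \<in> {1..n}})"


section \<open>Infinite matrices\<close>

text \<open>\<open>EE l k\<close> stands for \<open>\<E>\<^bsub>l,k\<^esub>\<close>; only half-integral indices \<open>l, k\<close> occur below.\<close>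

datatype glinf_basis = EE rat rat | Kappa0

type_synonym glinf = "glinf_basis \<Rightarrow>\<^sub>0 complex"

definition heaviside :: "rat \<Rightarrow> int" where
  "heaviside l = (if l > 0 then 1 else 0)"

text \<open>The floor only converts the integral rationals \<open>l + 1/2\<close> and \<open>-l + 1/2\<close> to type \<open>int\<close>.\<close>

definition alpha_half :: "nat \<Rightarrow> (nat \<Rightarrow> nat) \<Rightarrow> int \<Rightarrow> rat \<Rightarrow> rat \<Rightarrow> int" where
  "alpha_half n m \<iota>0 l1 l2 =
     heaviside (l1 + of_int ((int (m (res n \<lfloor>l1 + 1/2\<rfloor>)) - \<iota>0) * int n)) *
     heaviside (l2 + of_int ((\<iota>0 - int (m (res n \<lfloor>- l2 + 1/2\<rfloor>))) * int n))"

definition alpha :: "nat \<Rightarrow> (nat \<Rightarrow> nat) \<Rightarrow> int \<Rightarrow> rat \<Rightarrow> rat \<Rightarrow> rat \<Rightarrow> rat \<Rightarrow> int" where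
  "alpha n m \<iota>0 l1 l2 k1 k2 =
     (if l1 + k2 = 0 \<and> l2 + k1 = 0
      then alpha_half n m \<iota>0 l1 l2 - alpha_half n m \<iota>0 k1 k2 else 0)"

fun glinf_basis_bracket ::
  "nat \<Rightarrow> (nat \<Rightarrow> nat) \<Rightarrow> int \<Rightarrow> glinf_basis \<Rightarrow> glinf_basis \<Rightarrow> glinf" where
  "glinf_basis_bracket n m \<iota>0 (EE l1 l2) (EE k1 k2) =
     (if l2 + k1 = 0 then Poly_Mapping.single (EE l1 k2) 1 else 0)
   - (if k2 + l1 = 0 then Poly_Mapping.single (EE k1 l2) 1 else 0)
   + Poly_Mapping.single Kappa0 (of_int (alpha n m \<iota>0 l1 l2 k1 k2))"
| "glinf_basis_bracket n m \<iota>0 _ _ = 0"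

definition glinf_bracket :: "nat \<Rightarrow> (nat \<Rightarrow> nat) \<Rightarrow> int \<Rightarrow> glinf \<Rightarrow> glinf \<Rightarrow> glinf" where
  "glinf_bracket n m \<iota>0 = bilinear_ext (glinf_basis_bracket n m \<iota>0)"

definition kappa0 :: glinf where
  "kappa0 = Poly_Mapping.single Kappa0 1"

definition XX ::
  "inv_kind \<Rightarrow> nat \<Rightarrow> nat \<Rightarrow> (nat \<Rightarrow> nat) \<Rightarrow> nat \<Rightarrow> nat \<Rightarrow> int \<Rightarrow> int \<Rightarrow> glinf" where
  "XX \<tau> n \<epsilon> m i j l k =
     Poly_Mapping.single
       (EE (of_int l * of_nat n + of_nat i - 1/2) (of_int k * of_nat n - of_nat j + 1/2))
       ((-1) ^ \<epsilon> * ffact (ell \<epsilon> m j) (of_int k + of_nat (m j) + of_nat \<epsilon> - 3/2))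
   - Poly_Mapping.single
       (EE ((of_int k + of_nat \<epsilon> - 1) * of_nat n - of_nat j + 1/2)
           ((of_int l + 1 - of_nat \<epsilon>) * of_nat n + of_nat i - 1/2))
       (sgn_kind \<tau> n i j * ffact (ell \<epsilon> m i) (of_int l + of_nat (m i) + 1/2))"

text \<open>As a subspace this does not depend on \<open>\<iota>\<^sub>0\<close>; the bracket does.\<close>

definition LL :: "inv_kind \<Rightarrow> nat \<Rightarrow> nat \<Rightarrow> (nat \<Rightarrow> nat) \<Rightarrow> glinf set" where
  "LL \<tau> n \<epsilon> m =
     pm_span (insert kappa0 {XX \<tau> n \<epsilon> m i j l k | i j l k. i \<in> {1..n} \<and> j \<in> {1..n}})"

definition LL_tail :: "inv_kind \<Rightarrow> nat \<Rightarrow> nat \<Rightarrow> (nat \<Rightarrow> nat) \<Rightarrow> nat \<Rightarrow> glinf set" where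
  "LL_tail \<tau> n \<epsilon> m s =
     pm_span {XX \<tau> n \<epsilon> m i j l k | i j l k. i \<in> {1..n} \<and> j \<in> {1..n} \<and>
        (l \<ge> int s \<and> k \<le> - int s \<or> l \<le> - int s \<and> k \<ge> int s)}"

definition theta :: "nat \<Rightarrow> nat \<Rightarrow> int \<Rightarrow> glinf" where
  "theta n \<epsilon> l =
     Poly_Mapping.single (EE (of_int l - 1/2) (- of_int l + 1/2)) 1
   - Poly_Mapping.single
       (EE (- of_int l + (of_nat \<epsilon> - 1) * of_nat n + 1/2)
           (of_int l + (1 - of_nat \<epsilon>) * of_nat n - 1/2)) 1"

definition torus :: "nat \<Rightarrow> nat \<Rightarrow> glinf set" where
  "torus n \<epsilon> =
     pm_span (insert kappa0
       {theta n \<epsilon> l | l. l \<ge> (if \<epsilon> = 0 then - int (n div 2) else 0)})"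

definition ell_hat :: "nat \<Rightarrow> (nat \<Rightarrow> nat) \<Rightarrow> int \<Rightarrow> int" where
  "ell_hat n m \<iota>0 = \<bar>\<iota>0\<bar> + 1 + int (Max (m ` {1..n}))"


section \<open>The central correction coefficients and the representation \<open>\<sigma>\<close>\<close>

text \<open>
  The generating function is homogeneous of degree \<open>-1\<close> in \<open>x, y, z\<close>, so the power of \<open>z\<close>
  carries no information and we put \<open>z = 1\<close>. Bivariate power series are elements of
  \<open>complex fps fps\<close>: the outer variable \<open>fps_X\<close> is \<open>x\<close>, the inner one \<open>fps_const fps_X\<close> is
  \<open>y\<close>. Then \<open>((1 + y) / (1 + x))\<^bsup>\<iota>\<^esup> - 1\<close> is the following series.
\<close>

definition Im_numerator :: "complex \<Rightarrow> complex fps fps" where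
  "Im_numerator \<iota> =
     fps_const (fps_binomial \<iota>) * Abs_fps (\<lambda>p. fps_const (fps_nth (fps_binomial (- \<iota>)) p)) - 1"

definition Im_series :: "complex \<Rightarrow> complex fps fps" where
  "Im_series \<iota> = (THE g. (fps_X - fps_const fps_X) * g = Im_numerator \<iota>)"

lemma Im_numerator_nth:
  "fps_nth (fps_nth (Im_numerator \<iota>) p) q =
     (- \<iota> gchoose p) * (\<iota> gchoose q) - (if p = 0 \<and> q = 0 then 1 else 0)"
  by (simp add: Im_numerator_def fps_mult_right_const_nth mult.commute)

lemma Im_series_well_defined:
  "\<exists>!g. (fps_X - fps_const fps_X) * g = Im_numerator \<iota>"
proof (rule ex_ex1I)
  define F where "F p q = fps_nth (fps_nth (Im_numerator \<iota>) p) q" for p q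
  define G where "G p q = (\<Sum>i\<le>q. F (p + 1 + i) (q - i))" for p q
  define g where "g = Abs_fps (\<lambda>p. Abs_fps (G p))"
  have G_Suc: "G p (Suc q) = F (Suc p) (Suc q) + G (Suc p) q" for p q
    unfolding G_def by (subst sum.atMost_Suc_shift) simp
  have diag: "(\<Sum>i\<le>q. F i (q - i)) = 0" for q
  proof -
    have "(\<Sum>i\<le>q. (- \<iota> gchoose i) * (\<iota> gchoose (q - i))) = (if q = 0 then 1 else 0)"
      using gbinomial_Vandermonde[of "- \<iota>" \<iota> q]
      by (cases q) (simp_all add: atLeast0AtMost)
    moreover have "(\<Sum>i\<le>q. if i = 0 \<and> q - i = 0 then 1 else (0::complex)) = (if q = 0 then 1 else 0)"
      by (cases q) (auto intro!: sum.neutral)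
    ultimately show ?thesis
      by (simp add: F_def Im_numerator_nth sum_subtractf)
  qed
  have F0: "F 0 0 = 0" using diag[of 0] by simp
  have G0: "- G 0 q = F 0 (Suc q)" for q
  proof -
    have "F 0 (Suc q) + G 0 q = 0"
      using diag[of "Suc q"] unfolding G_def by (subst (asm) sum.atMost_Suc_shift) simp
    then show ?thesis by (metis add.commute minus_unique)
  qed
  have "fps_nth (fps_nth ((fps_X - fps_const fps_X) * g) p) q = F p q" for p q
    by (cases p; cases q)
       (simp_all add: left_diff_distrib g_def G_Suc G0 F0, simp_all add: G_def)
  then show "\<exists>g. (fps_X - fps_const fps_X) * g = Im_numerator \<iota>"
    unfolding F_def by (intro exI[of _ g] fps_ext) auto
next
  fix g h :: "complex fps fps"
  assume "(fps_X - fps_const fps_X) * g = Im_numerator \<iota>"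
    and "(fps_X - fps_const fps_X) * h = Im_numerator \<iota>"
  then have eq: "(fps_X - fps_const fps_X) * g = (fps_X - fps_const fps_X) * h" by simp
  have "fps_nth (fps_X - fps_const fps_X :: complex fps fps) 1 \<noteq> 0" by simp
  then have "fps_X - fps_const fps_X \<noteq> (0 :: complex fps fps)" by (metis fps_zero_nth)
  with eq show "g = h" by simp
qed

definition Im_coeff :: "complex \<Rightarrow> nat \<Rightarrow> nat \<Rightarrow> complex" where
  "Im_coeff \<iota> r1 r2 = fps_nth (fps_nth (Im_series \<iota>) r1) r2"

text \<open>
  \<open>\<sigma>\<close> is the representation \<open>\<sigma>\<^sub>\<tau>\<close> attached to the \<open>LL\<close>-module \<open>\<rho>\<close>. The library's
  \<open>Sum_any\<close> is the sum over all \<open>l :: int\<close> with nonzero summand; for the modules considered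
  only finitely many summands are nonzero on any given vector.
\<close>

definition sigma_rep ::
  "(complex \<Rightarrow> 'm::ab_group_add \<Rightarrow> 'm) \<Rightarrow> inv_kind \<Rightarrow> nat \<Rightarrow> nat \<Rightarrow> (nat \<Rightarrow> nat) \<Rightarrow> int
    \<Rightarrow> (glinf \<Rightarrow> 'm \<Rightarrow> 'm) \<Rightarrow> (glA \<Rightarrow> 'm \<Rightarrow> 'm) \<Rightarrow> bool" where
  "sigma_rep scale \<tau> n \<epsilon> m \<iota>0 \<rho> \<sigma> \<longleftrightarrow>
     lie_rep scale (dop_algebra \<tau> n \<epsilon> m) glA_bracket \<sigma> \<and>
     (\<forall>v. \<sigma> (Poly_Mapping.single Kappa 1) v = \<rho> kappa0 v) \<and>
     (\<forall>i\<in>{1..n}. \<forall>j\<in>{1..n}. \<forall>k::int. \<forall>r v.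
        \<sigma> (dop_gen \<tau> n \<epsilon> m i j r (k + int (m i + m j + r + \<epsilon>))) v =
          Sum_any (\<lambda>l::int.
            scale (ffact r (of_int l - of_nat (m j) - of_nat \<epsilon> + 1/2))
              (\<rho> (XX \<tau> n \<epsilon> m i j (k + l) (- l)) v))
          + scale
              ((fact (r + ell \<epsilon> m i) * Im_coeff (of_int \<iota>0 + 1/2) 0 (r + ell \<epsilon> m i)
                - (-1) ^ \<epsilon> * fact r * fact (ell \<epsilon> m i)
                    * Im_coeff (of_int \<iota>0 + 1/2) r (ell \<epsilon> m i))
               * (if k = 0 \<and> i = j then 1 else 0))
              (\<rho> kappa0 v))"

end

theory Submission
  imports Defs
begin

text \<open>
  A subspace is stable under \<open>\<sigma>\<close> exactly when it is stable under \<open>\<rho>\<close>, so the two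
  representations have the same submodules and are irreducible together.

  A \<open>\<rho>\<close>-stable subspace is \<open>\<sigma>\<close>-stable because every \<open>\<sigma>\<close>-generator acts on each
  vector as a finite linear combination of operators \<open>\<rho> x\<close>.  Conversely, fix \<open>i, j, k\<close> and a
  vector \<open>v\<close> and look at the family \<open>f l = \<rho> (X\<^bsub>i,j\<^esub>(k + l, -l)) v\<close>.  The \<open>\<sigma>\<close>-generators
  that share \<open>i, j, k\<close> and differ in the order \<open>r\<close> of differentiation produce, up to a multiple
  of \<open>\<rho> \<kappa>\<^sub>0 v = \<sigma> \<kappa> v\<close>, all the moments
  \<open>\<Sum>l. \<langle>a l\<rangle>\<^sub>r f l\<close> of this family, where \<open>a l = l - m\<^sub>j - \<epsilon> + 1/2\<close> are distinct points.
  Falling factorials span all polynomials, so if \<open>f\<close> has finite support, an interpolating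
  polynomial isolates every single \<open>f l\<close>
  (\<open>mem_subspace_of_factorial_moments\<close>), which therefore stays in any \<open>\<sigma>\<close>-stable subspace
  containing \<open>v\<close>.

  The support of \<open>f\<close> is finite for all \<open>v\<close> (\<open>finite_support_on_diagonals\<close>): this holds on the
  generating space because \<open>X\<^bsub>i,j\<^esub>(k + l, -l)\<close> lies in the annihilating tail for large \<open>\<bar>l\<bar>\<close>,
  and it propagates along the action because a fixed finite matrix commutes with
  \<open>X\<^bsub>i,j\<^esub>(k + l, -l)\<close>, cocycle included, for all but finitely many \<open>l\<close>.
\<close>

section \<open>Submodules of a representation of a spanned Lie algebra\<close>

lemma lie_rep_zero:
  assumes "vector_space scale" "lie_rep scale (pm_span B) br \<rho>"
  shows "\<rho> 0 v = 0"
proof -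
  interpret V: vector_space scale by fact
  interpret P: vector_space pm_scale by (rule vector_space_pm_scale)
  have "\<rho> (pm_scale 0 0) v = scale 0 (\<rho> 0 v)"
    using assms(2) P.span_zero[of B] unfolding lie_rep_def by blast
  then show ?thesis by simp
qed

lemma submodule_span_iff:
  assumes vs: "vector_space scale" and rep: "lie_rep scale (pm_span B) br \<rho>"
  shows "submodule scale (pm_span B) \<rho> U \<longleftrightarrow>
           module.subspace scale U \<and> (\<forall>b\<in>B. \<forall>u\<in>U. \<rho> b u \<in> U)"
proof
  interpret P: vector_space pm_scale by (rule vector_space_pm_scale)
  assume "submodule scale (pm_span B) \<rho> U"
  then show "module.subspace scale U \<and> (\<forall>b\<in>B. \<forall>u\<in>U. \<rho> b u \<in> U)"
    unfolding submodule_def using P.span_base by blast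
next
  interpret V: vector_space scale by fact
  interpret P: vector_space pm_scale by (rule vector_space_pm_scale)
  assume U: "V.subspace U \<and> (\<forall>b\<in>B. \<forall>u\<in>U. \<rho> b u \<in> U)"
  let ?S = "{x \<in> P.span B. \<forall>u\<in>U. \<rho> x u \<in> U}"
  have "P.subspace ?S"
  proof (rule P.subspaceI)
    show "0 \<in> ?S"
      using U lie_rep_zero[OF vs rep] by (simp add: P.span_zero V.subspace_0)
    show "x + y \<in> ?S" if "x \<in> ?S" "y \<in> ?S" for x y
      using that U rep by (simp add: lie_rep_def P.span_add V.subspace_add)
    show "pm_scale c x \<in> ?S" if "x \<in> ?S" for c x
      using that U rep by (simp add: lie_rep_def P.span_scale V.subspace_scale)
  qed
  moreover have "B \<subseteq> ?S" using U P.span_base by blast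
  ultimately have "P.span B \<subseteq> ?S" by (rule P.span_minimal[rotated])
  then show "submodule scale (P.span B) \<rho> U"
    unfolding submodule_def using U by blast
qed

section \<open>Interpolation by falling factorials\<close>

lemma ffact_Suc: "ffact (Suc r) x = (x - of_nat r) * ffact r x"
  by (simp add: ffact_def)

text \<open>
  Lagrange interpolation in the basis of falling factorials.  Since
  \<open>(x - c) \<langle>x\<rangle>\<^sub>r = \<langle>x\<rangle>\<^bsub>r+1\<^esub> + (r - c) \<langle>x\<rangle>\<^sub>r\<close>, the weights \<open>\<langle>x\<rangle>\<^sub>r\<close> may be multiplied by linear
  factors one at a time, until all points but one are killed.
\<close>

lemma mem_subspace_of_factorial_moments:
  fixes a :: "'l \<Rightarrow> complex"
  assumes "vector_space scale" and "module.subspace scale U"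
    and fin: "finite S" and inj: "inj_on a S"
    and moments: "\<And>r. (\<Sum>l\<in>S. scale (ffact r (a l)) (f l)) \<in> U"
    and "l0 \<in> S"
  shows "f l0 \<in> U"
proof -
  interpret V: vector_space scale by fact
  have *: "(\<Sum>l\<in>S. scale (ffact r (a l) * (\<Prod>t\<in>T. a l - a t)) (f l)) \<in> U" if "finite T" for T r
    using that
  proof (induction T arbitrary: r)
    case empty
    then show ?case using moments by simp
  next
    case (insert c T)
    let ?w = "\<lambda>r l. ffact r (a l) * (\<Prod>t\<in>T. a l - a t)"
    have "scale (ffact r (a l) * (\<Prod>t\<in>insert c T. a l - a t)) (f l)
        = scale (?w (Suc r) l) (f l) + scale (of_nat r - a c) (scale (?w r l) (f l))" for l
    proof -
      have "ffact r (a l) * (\<Prod>t\<in>insert c T. a l - a t) = ?w (Suc r) l + (of_nat r - a c) * ?w r l"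
        using insert.hyps by (simp add: ffact_Suc algebra_simps)
      then show ?thesis by (simp add: V.scale_left_distrib)
    qed
    then have "(\<Sum>l\<in>S. scale (ffact r (a l) * (\<Prod>t\<in>insert c T. a l - a t)) (f l))
        = (\<Sum>l\<in>S. scale (?w (Suc r) l) (f l))
          + scale (of_nat r - a c) (\<Sum>l\<in>S. scale (?w r l) (f l))"
      by (simp only: sum.distrib V.scale_sum_right)
    also have "\<dots> \<in> U"
      using insert.IH assms(2) by (intro V.subspace_add V.subspace_scale) auto
    finally show ?case .
  qed
  define c where "c = (\<Prod>t\<in>S - {l0}. a l0 - a t)"
  have "(\<Sum>l\<in>S. scale (ffact 0 (a l) * (\<Prod>t\<in>S - {l0}. a l - a t)) (f l))
      = (\<Sum>l\<in>S. if l = l0 then scale c (f l0) else 0)"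
  proof (rule sum.cong[OF refl])
    fix l assume "l \<in> S"
    then show "scale (ffact 0 (a l) * (\<Prod>t\<in>S - {l0}. a l - a t)) (f l)
        = (if l = l0 then scale c (f l0) else 0)"
      using fin by (auto simp: ffact_def c_def prod_zero_iff)
  qed
  also have "\<dots> = scale c (f l0)" using fin \<open>l0 \<in> S\<close> by simp
  finally have "scale c (f l0) \<in> U" using *[of "S - {l0}" 0] fin by simp
  moreover have "c \<noteq> 0"
    using fin inj \<open>l0 \<in> S\<close> by (auto simp: c_def inj_on_def)
  ultimately have "scale (inverse c) (scale c (f l0)) \<in> U"
    using assms(2) V.subspace_scale by blast
  then show ?thesis using \<open>c \<noteq> 0\<close> by simp
qed

section \<open>Finite support along diagonals\<close>

lemma finite_fiber_inj:
  assumes "inj p" shows "finite {l. p l = z}"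
  using finite_vimageI[of "{z}" p] assms by (simp add: vimage_def)

text \<open>
  Two matrix units can only fail to commute, or have a nonzero cocycle, when an inner pair of
  indices cancels, and an injective index function meets a given value at most once.
\<close>

lemma finite_noncommuting_units:
  assumes "inj p" "inj q"
  shows "finite {l. glinf_basis_bracket n m \<iota>0 (EE (p l) (q l)) b \<noteq> 0}"
proof (cases b)
  case (EE k1 k2)
  have "{l. glinf_basis_bracket n m \<iota>0 (EE (p l) (q l)) b \<noteq> 0}
      \<subseteq> {l. p l = - k2} \<union> {l. q l = - k1}"
    using EE by (auto simp: alpha_def eq_neg_iff_add_eq_0 add.commute)
  then show ?thesis
    by (rule finite_subset) (simp add: finite_fiber_inj assms)
qed simp

lemma bilinear_ext_eq_0:
  assumes "\<And>a b. a \<in> Poly_Mapping.keys x \<Longrightarrow> b \<in> Poly_Mapping.keys y \<Longrightarrow> c a b = 0"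
  shows "bilinear_ext c x y = 0"
proof -
  interpret P: vector_space pm_scale by (rule vector_space_pm_scale)
  show ?thesis unfolding bilinear_ext_def using assms by simp
qed

text \<open>Both matrix units in \<open>X\<^bsub>i,j\<^esub>(k + l, -l)\<close> move off to infinity with \<open>l\<close>, while \<open>x\<close> is a
  finite matrix.\<close>

lemma finite_noncommuting_XX:
  assumes "n \<ge> 1"
  shows "finite {l. glinf_bracket n m \<iota>0 (XX \<tau> n \<epsilon> m i j (k + l) (- l)) x \<noteq> 0}"
proof -
  define p1 :: "int \<Rightarrow> rat" where "p1 l = of_int (k + l) * of_nat n + of_nat i - 1/2" for l
  define q1 :: "int \<Rightarrow> rat" where "q1 l = of_int (- l) * of_nat n - of_nat j + 1/2" for l
  define p2 :: "int \<Rightarrow> rat"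
    where "p2 l = (of_int (- l) + of_nat \<epsilon> - 1) * of_nat n - of_nat j + 1/2" for l
  define q2 :: "int \<Rightarrow> rat"
    where "q2 l = (of_int (k + l) + 1 - of_nat \<epsilon>) * of_nat n + of_nat i - 1/2" for l
  have inj: "inj p1" "inj q1" "inj p2" "inj q2"
    using assms by (auto simp: inj_def p1_def q1_def p2_def q2_def)
  let ?B = "glinf_basis_bracket n m \<iota>0"
  have keys: "Poly_Mapping.keys (XX \<tau> n \<epsilon> m i j (k + l) (- l)) \<subseteq> {EE (p1 l) (q1 l), EE (p2 l) (q2 l)}"
    for l
    unfolding XX_def p1_def q1_def p2_def q2_def
    by (rule order_trans[OF keys_diff]) (auto split: if_splits)
  have "{l. glinf_bracket n m \<iota>0 (XX \<tau> n \<epsilon> m i j (k + l) (- l)) x \<noteq> 0}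
      \<subseteq> (\<Union>b\<in>Poly_Mapping.keys x.
            {l. ?B (EE (p1 l) (q1 l)) b \<noteq> 0} \<union> {l. ?B (EE (p2 l) (q2 l)) b \<noteq> 0})" (is "_ \<subseteq> ?R")
  proof
    fix l assume l: "l \<in> {l. glinf_bracket n m \<iota>0 (XX \<tau> n \<epsilon> m i j (k + l) (- l)) x \<noteq> 0}"
    show "l \<in> ?R"
    proof (rule ccontr)
      assume "l \<notin> ?R"
      then have "?B a b = 0"
        if "a \<in> Poly_Mapping.keys (XX \<tau> n \<epsilon> m i j (k + l) (- l))" "b \<in> Poly_Mapping.keys x" for a b
        using that keys[of l] by auto
      then have "glinf_bracket n m \<iota>0 (XX \<tau> n \<epsilon> m i j (k + l) (- l)) x = 0"
        unfolding glinf_bracket_def by (rule bilinear_ext_eq_0)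
      with l show False by simp
    qed
  qed
  moreover have "finite ?R"
    by (intro finite_UN_I finite_keys finite_UnI finite_noncommuting_units inj)
  ultimately show ?thesis by (rule finite_subset)
qed

text \<open>Where \<open>f l\<close> and \<open>x\<close> commute, \<open>\<rho> (f l) (\<rho> x v) = \<rho> x (\<rho> (f l) v)\<close>, so applying \<open>\<rho> x\<close> to
  \<open>v\<close> enlarges the support at most by the noncommuting positions.\<close>

lemma finite_support_image:
  fixes f :: "'l \<Rightarrow> 'b \<Rightarrow>\<^sub>0 complex"
  assumes "vector_space scale" and rep: "lie_rep scale (pm_span B) br \<rho>"
    and x: "x \<in> pm_span B" and f: "\<And>l. f l \<in> pm_span B"
    and br: "finite {l. br (f l) x \<noteq> 0}" and v: "finite {l. \<rho> (f l) v \<noteq> 0}"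
  shows "finite {l. \<rho> (f l) (\<rho> x v) \<noteq> 0}"
proof (rule finite_subset)
  interpret V: vector_space scale by fact
  show "{l. \<rho> (f l) (\<rho> x v) \<noteq> 0} \<subseteq> {l. br (f l) x \<noteq> 0} \<union> {l. \<rho> (f l) v \<noteq> 0}"
  proof (rule subsetI, rule ccontr)
    fix l assume l: "l \<in> {l. \<rho> (f l) (\<rho> x v) \<noteq> 0}"
      and "l \<notin> {l. br (f l) x \<noteq> 0} \<union> {l. \<rho> (f l) v \<noteq> 0}"
    then have 0: "br (f l) x = 0" "\<rho> (f l) v = 0" by auto
    have "\<rho> (br (f l) x) v = \<rho> (f l) (\<rho> x v) - \<rho> x (\<rho> (f l) v)"
      using rep x f unfolding lie_rep_def by blast
    moreover have "\<rho> x 0 = 0"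
    proof -
      have "Vector_Spaces.linear scale scale (\<rho> x)"
        using rep x unfolding lie_rep_def by blast
      then interpret l: Vector_Spaces.linear scale scale "\<rho> x" .
      show ?thesis by (rule l.zero)
    qed
    ultimately have "\<rho> (f l) (\<rho> x v) = 0"
      using 0 lie_rep_zero[OF assms(1) rep] by simp
    with l show False by simp
  qed
  show "finite ({l. br (f l) x \<noteq> 0} \<union> {l. \<rho> (f l) v \<noteq> 0})"
    using br v by simp
qed

lemma XX_in_LL:
  assumes "i \<in> {1..n}" "j \<in> {1..n}"
  shows "XX \<tau> n \<epsilon> m i j l k \<in> LL \<tau> n \<epsilon> m"
proof -
  interpret P: vector_space pm_scale by (rule vector_space_pm_scale)
  show ?thesis
    unfolding LL_def using assms by (intro P.span_base) blast
qed

text \<open>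
  For fixed \<open>i, j, k\<close> the vectors with finite support form a submodule, by
  \<open>finite_support_image\<close> and \<open>finite_noncommuting_XX\<close>.  It contains the generating set \<open>M0\<close>: if
  \<open>\<bar>l\<bar> > s + \<bar>k\<bar>\<close>, the indices \<open>k + l\<close> and \<open>-l\<close> have opposite signs and absolute value at least
  \<open>s\<close>.
\<close>

lemma finite_support_on_diagonals:
  assumes vs: "vector_space scale"
    and n: "n \<ge> 1"
    and rep: "lie_rep scale (LL \<tau> n \<epsilon> m) (glinf_bracket n m \<iota>0) \<rho>"
    and gen: "generated_submodule scale (LL \<tau> n \<epsilon> m) \<rho> M0 = UNIV"
    and tail: "\<And>x v. x \<in> LL_tail \<tau> n \<epsilon> m s \<Longrightarrow> v \<in> M0 \<Longrightarrow> \<rho> x v = 0"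
    and ij: "i \<in> {1..n}" "j \<in> {1..n}"
  shows "finite {l. \<rho> (XX \<tau> n \<epsilon> m i j (k + l) (- l)) v \<noteq> 0}"
proof -
  interpret V: vector_space scale by fact
  interpret P: vector_space pm_scale by (rule vector_space_pm_scale)
  define f where "f l = XX \<tau> n \<epsilon> m i j (k + l) (- l)" for l
  have f_in: "f l \<in> LL \<tau> n \<epsilon> m" for l
    unfolding f_def using ij by (rule XX_in_LL)
  have lin: "\<rho> (f l) (u + w) = \<rho> (f l) u + \<rho> (f l) w"
    "\<rho> (f l) (scale c u) = scale c (\<rho> (f l) u)" for l u w c
  proof -
    have "Vector_Spaces.linear scale scale (\<rho> (f l))"
      using rep f_in unfolding lie_rep_def by blast
    then interpret l: Vector_Spaces.linear scale scale "\<rho> (f l)" .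
    show "\<rho> (f l) (u + w) = \<rho> (f l) u + \<rho> (f l) w" by (rule l.add)
    show "\<rho> (f l) (scale c u) = scale c (\<rho> (f l) u)" by (rule l.scale)
  qed
  define W where "W = {v. finite {l. \<rho> (f l) v \<noteq> 0}}"
  have "V.subspace W"
  proof (rule V.subspaceI)
    have "\<rho> (f l) 0 = 0" for l using lin(2)[of l 0 0] by simp
    then show "0 \<in> W" by (simp add: W_def)
    show "u + w \<in> W" if "u \<in> W" "w \<in> W" for u w
    proof -
      have "{l. \<rho> (f l) (u + w) \<noteq> 0} \<subseteq> {l. \<rho> (f l) u \<noteq> 0} \<union> {l. \<rho> (f l) w \<noteq> 0}"
        by (auto simp: lin)
      then show ?thesis using that unfolding W_def by (simp add: finite_subset)
    qed
    show "scale c u \<in> W" if "u \<in> W" for c u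
    proof -
      have "{l. \<rho> (f l) (scale c u) \<noteq> 0} \<subseteq> {l. \<rho> (f l) u \<noteq> 0}"
        by (auto simp: lin)
      then show ?thesis using that unfolding W_def by (simp add: finite_subset)
    qed
  qed
  moreover have "\<rho> x u \<in> W" if "x \<in> LL \<tau> n \<epsilon> m" "u \<in> W" for x u
  proof -
    have "finite {l. glinf_bracket n m \<iota>0 (f l) x \<noteq> 0}"
      unfolding f_def using n by (rule finite_noncommuting_XX)
    then show ?thesis
      using that rep f_in unfolding W_def LL_def
      by (auto intro!: finite_support_image[OF vs])
  qed
  moreover have "M0 \<subseteq> W"
  proof
    fix u assume "u \<in> M0"
    let ?b = "int s + \<bar>k\<bar>"
    have "\<rho> (f l) u = 0" if "l \<notin> {- ?b..?b}" for l
    proof (rule tail[OF _ \<open>u \<in> M0\<close>])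
      have "k + l \<ge> int s \<and> - l \<le> - int s \<or> k + l \<le> - int s \<and> - l \<ge> int s"
        using that by auto
      then show "f l \<in> LL_tail \<tau> n \<epsilon> m s"
        unfolding f_def LL_tail_def using ij by (intro P.span_base) blast
    qed
    then have "{l. \<rho> (f l) u \<noteq> 0} \<subseteq> {- ?b..?b}" by blast
    then show "u \<in> W" unfolding W_def by (simp add: finite_subset)
  qed
  ultimately have "generated_submodule scale (LL \<tau> n \<epsilon> m) \<rho> M0 \<subseteq> W"
    unfolding generated_submodule_def submodule_def by blast
  then show ?thesis using gen by (auto simp: W_def f_def)
qed

section \<open>Comparison of the submodules\<close>

lemma Sum_any_in_subspace:
  assumes "vector_space scale" "module.subspace scale U" "\<And>l. g l \<in> U"
  shows "Sum_any g \<in> U"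
proof -
  interpret V: vector_space scale by fact
  show ?thesis
    using assms(2,3) by (simp add: Sum_any.expand_set V.subspace_sum V.subspace_0)
qed

text \<open>
  The \<open>\<kappa>\<^sub>0\<close>-correction in \<open>\<sigma>\<close> is harmless because \<open>\<sigma> \<kappa> = \<rho> \<kappa>\<^sub>0\<close> preserves submodules of either kind.
  Hence the moments themselves can be extracted from \<open>\<sigma>\<close>.
\<close>

lemma sigma_submodule_iff:
  assumes vs: "vector_space scale"
    and n: "n \<ge> 1"
    and rep: "lie_rep scale (LL \<tau> n \<epsilon> m) (glinf_bracket n m \<iota>0) \<rho>"
    and gen: "generated_submodule scale (LL \<tau> n \<epsilon> m) \<rho> M0 = UNIV"
    and tail: "\<And>x v. x \<in> LL_tail \<tau> n \<epsilon> m s \<Longrightarrow> v \<in> M0 \<Longrightarrow> \<rho> x v = 0"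
    and sigma: "sigma_rep scale \<tau> n \<epsilon> m \<iota>0 \<rho> \<sigma>"
  shows "submodule scale (dop_algebra \<tau> n \<epsilon> m) \<sigma> U \<longleftrightarrow> submodule scale (LL \<tau> n \<epsilon> m) \<rho> U"
proof -
  interpret V: vector_space scale by fact
  define a :: "nat \<Rightarrow> int \<Rightarrow> complex" where "a j l = of_int l - of_nat (m j) - of_nat \<epsilon> + 1/2" for j l
  define f where "f i j k v l = \<rho> (XX \<tau> n \<epsilon> m i j (k + l) (- l)) v" for i j k v l
  define corr :: "nat \<Rightarrow> nat \<Rightarrow> int \<Rightarrow> nat \<Rightarrow> complex" where "corr i j k r =
      (fact (r + ell \<epsilon> m i) * Im_coeff (of_int \<iota>0 + 1/2) 0 (r + ell \<epsilon> m i)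
        - (-1) ^ \<epsilon> * fact r * fact (ell \<epsilon> m i) * Im_coeff (of_int \<iota>0 + 1/2) r (ell \<epsilon> m i))
       * (if k = 0 \<and> i = j then 1 else 0)" for i j k r
  have sig_rep: "lie_rep scale (dop_algebra \<tau> n \<epsilon> m) glA_bracket \<sigma>"
    using sigma by (simp add: sigma_rep_def)
  have kappa: "\<sigma> (Poly_Mapping.single Kappa 1) v = \<rho> kappa0 v" for v
    using sigma by (simp add: sigma_rep_def)
  have sig: "\<sigma> (dop_gen \<tau> n \<epsilon> m i j r (k + int (m i + m j + r + \<epsilon>))) v =
      Sum_any (\<lambda>l. scale (ffact r (a j l)) (f i j k v l)) + scale (corr i j k r) (\<rho> kappa0 v)"
    if "i \<in> {1..n}" "j \<in> {1..n}" for i j k r v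
    using sigma that unfolding sigma_rep_def a_def f_def corr_def by blast
  have sub_dop: "submodule scale (dop_algebra \<tau> n \<epsilon> m) \<sigma> U \<longleftrightarrow> V.subspace U \<and>
      (\<forall>x \<in> insert (Poly_Mapping.single Kappa 1)
         {dop_gen \<tau> n \<epsilon> m i j r N | i j r N. i \<in> {1..n} \<and> j \<in> {1..n}}. \<forall>u\<in>U. \<sigma> x u \<in> U)"
    unfolding dop_algebra_def
    by (rule submodule_span_iff[OF vs sig_rep[unfolded dop_algebra_def]])
  have sub_LL: "submodule scale (LL \<tau> n \<epsilon> m) \<rho> U \<longleftrightarrow> V.subspace U \<and>
      (\<forall>x \<in> insert kappa0 {XX \<tau> n \<epsilon> m i j l k | i j l k. i \<in> {1..n} \<and> j \<in> {1..n}}.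
         \<forall>u\<in>U. \<rho> x u \<in> U)"
    unfolding LL_def by (rule submodule_span_iff[OF vs rep[unfolded LL_def]])
  show ?thesis
  proof
    assume A: "submodule scale (dop_algebra \<tau> n \<epsilon> m) \<sigma> U"
    then have sub: "V.subspace U" by (simp add: sub_dop)
    have k0: "\<rho> kappa0 u \<in> U" if "u \<in> U" for u
      using A that unfolding sub_dop by (simp flip: kappa)
    have X: "\<rho> (XX \<tau> n \<epsilon> m i j l0 k0) u \<in> U"
      if u: "u \<in> U" and ij: "i \<in> {1..n}" "j \<in> {1..n}" for u i j l0 k0
    proof -
      \<comment> \<open>\<open>X\<^bsub>i,j\<^esub>(l0, k0)\<close> is the entry at \<open>- k0\<close> of the diagonal \<open>l0 + k0\<close>.\<close>
      define k where "k = l0 + k0"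
      define S where "S = insert (- k0) {l. f i j k u l \<noteq> 0}"
      have fin: "finite S"
        unfolding S_def f_def using finite_support_on_diagonals[OF vs n rep gen tail ij] by simp
      have "(\<Sum>l\<in>S. scale (ffact r (a j l)) (f i j k u l)) \<in> U" for r
      proof -
        have "\<sigma> (dop_gen \<tau> n \<epsilon> m i j r (k + int (m i + m j + r + \<epsilon>))) u \<in> U"
          using A ij u unfolding sub_dop by blast
        then have "Sum_any (\<lambda>l. scale (ffact r (a j l)) (f i j k u l))
            + scale (corr i j k r) (\<rho> kappa0 u) - scale (corr i j k r) (\<rho> kappa0 u) \<in> U"
          unfolding sig[OF ij] by (intro V.subspace_diff V.subspace_scale sub k0 u)
        then have "Sum_any (\<lambda>l. scale (ffact r (a j l)) (f i j k u l)) \<in> U"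
          by (simp only: add_diff_cancel_right')
        moreover have "Sum_any (\<lambda>l. scale (ffact r (a j l)) (f i j k u l))
            = (\<Sum>l\<in>S. scale (ffact r (a j l)) (f i j k u l))"
          by (rule Sum_any.expand_superset[OF fin]) (auto simp: S_def)
        ultimately show ?thesis by simp
      qed
      moreover have "inj_on (a j) S" "- k0 \<in> S"
        by (auto simp: inj_on_def a_def S_def)
      ultimately have "f i j k u (- k0) \<in> U"
        using mem_subspace_of_factorial_moments[OF vs sub fin, of "a j" "f i j k u"] by blast
      then show ?thesis by (simp add: f_def k_def)
    qed
    show "submodule scale (LL \<tau> n \<epsilon> m) \<rho> U"
      unfolding sub_LL using sub k0 X by blast
  next
    assume A: "submodule scale (LL \<tau> n \<epsilon> m) \<rho> U"
    then have sub: "V.subspace U" by (simp add: sub_LL)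
    have k0: "\<rho> kappa0 u \<in> U" if "u \<in> U" for u
      using A that unfolding sub_LL by blast
    have D: "\<sigma> (dop_gen \<tau> n \<epsilon> m i j r N) u \<in> U"
      if u: "u \<in> U" and ij: "i \<in> {1..n}" "j \<in> {1..n}" for u i j r N
    proof -
      define k where "k = N - int (m i + m j + r + \<epsilon>)"
      have "f i j k u l \<in> U" for l
        using A u ij unfolding sub_LL f_def by blast
      then have "Sum_any (\<lambda>l. scale (ffact r (a j l)) (f i j k u l)) \<in> U"
        by (intro Sum_any_in_subspace[OF vs sub] V.subspace_scale[OF sub])
      then have "\<sigma> (dop_gen \<tau> n \<epsilon> m i j r (k + int (m i + m j + r + \<epsilon>))) u \<in> U"
        unfolding sig[OF ij] by (intro V.subspace_add V.subspace_scale sub k0 u)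
      then show ?thesis by (simp add: k_def)
    qed
    have "\<sigma> (Poly_Mapping.single Kappa 1) u \<in> U" if "u \<in> U" for u
      using k0[OF that] by (simp add: kappa)
    then show "submodule scale (dop_algebra \<tau> n \<epsilon> m) \<sigma> U"
      unfolding sub_dop using sub D by blast
  qed
qed

theorem theorem4p2:
  fixes n \<epsilon> s :: nat and m :: "nat \<Rightarrow> nat" and \<iota>0 :: int and \<tau> :: inv_kind
    and scale :: "complex \<Rightarrow> 'm::ab_group_add \<Rightarrow> 'm"
    and \<rho> :: "glinf \<Rightarrow> 'm \<Rightarrow> 'm" and \<sigma> :: "glA \<Rightarrow> 'm \<Rightarrow> 'm" and M0 :: "'m set"
  assumes "n \<ge> 1" and "\<epsilon> \<in> {0, 1}"
    and "\<And>i. i \<in> {1..n} \<Longrightarrow> m (star n i) = m i"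
    and "\<tau> = Dagger \<Longrightarrow> even n"
    and "vector_space scale"
    and "lie_rep scale (LL \<tau> n \<epsilon> m) (glinf_bracket n m \<iota>0) \<rho>"
    and "weighted scale (torus n \<epsilon>) \<rho>"
    and "module.subspace scale M0"
    and "generated_submodule scale (LL \<tau> n \<epsilon> m) \<rho> M0 = UNIV"
    and "int s > ell_hat n m \<iota>0"
    and "\<And>x v. x \<in> LL_tail \<tau> n \<epsilon> m s \<Longrightarrow> v \<in> M0 \<Longrightarrow> \<rho> x v = 0"
    and "sigma_rep scale \<tau> n \<epsilon> m \<iota>0 \<rho> \<sigma>"
  shows "irreducible_rep scale (dop_algebra \<tau> n \<epsilon> m) \<sigma>
    \<longleftrightarrow> irreducible_rep scale (LL \<tau> n \<epsilon> m) \<rho>"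
proof -
  have "submodule scale (dop_algebra \<tau> n \<epsilon> m) \<sigma> U \<longleftrightarrow> submodule scale (LL \<tau> n \<epsilon> m) \<rho> U" for U
    using assms by (intro sigma_submodule_iff[where ?M0.0 = M0 and s = s])
  then show ?thesis unfolding irreducible_rep_def by simp
qed

end
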